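(* Let $\mathcal{C}=\mathbb{S}\cap\mathbb{R}^n_{++}$ and let $f:\mathcal{C}\to\mathbb{R}$ be defined by $f(x)=\langle Ax,x\rangle$, where $A=A^T\in\mathbb{R}^{n\times n}$. Then $f$ is spherically convex if and only if there exists $\lambda\in\mathbb{R}$ such that $A=\lambda I_n$. In this case, $f$ is a constant function.
   Context: $\mathbb{R}^n$ is the $n$-dimensional Euclidean space with the canonical inner product $\langle\cdot,\cdot\rangle$ and norm $\|\cdot\|$; $\mathbb{S}=\{x\in\mathbb{R}^n:\|x\|=1\}$ is the unit sphere; $\mathbb{R}^n_{++}$ is the positive orthant, i.e. the set of vectors with all coordinates strictly positive; $I_n$ is the $n\times n$ identity matrix. A geodesic of $\mathbb{S}$ is the intersection curve of a plane through the origin with $\mathbb{S}$, parameterized with constant speed; a geodesic segment $\gamma:[a,b]\to\mathbb{S}$ is minimal if its arc length equals $\arccos\langle\gamma(a),\gamma(b)\rangle$. A set $C\subseteq\mathbb{S}$ is spherically convex if for any $x,y\in C$ all minimal geodesic segments joining $x$ to $y$ are contained in $C$. For a spherically convex set $C$, a function $f:C\to\mathbb{R}$ is spherically convex if for every minimal geodesic segment $\gamma:I\to C$ ($I\subset\mathbb{R}$ an interval) the composition $f\circ\gamma:I\to\mathbb{R}$ is convex in the usual sense.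
   Formalization: The dimension n = 2 is excluded because the claim fails there: for A with rows (0,-1) and (-1,0), f(x) = -2 x_1 x_2 = -sin 2t is spherically convex on the open quarter circle, yet A is not a multiple of I_2 and f is not constant. *)

theory Defs
  imports "HOL-Analysis.Analysis"
begin

definition positive_orthant :: "(real ^ 'n) set" where
  "positive_orthant = {x. \<forall>i. 0 < x $ i}"

definition great_circle :: "'a::euclidean_space set \<Rightarrow> bool" where
  "great_circle S \<longleftrightarrow> (\<exists>P. subspace P \<and> dim P = 2 \<and> S = P \<inter> sphere 0 1)"

text \<open>Derivatives at the end points are one-sided. The speed may be \<open>0\<close>, so that constant
  curves count as (degenerate) geodesic segments.\<close>

definition constant_speed :: "(real \<Rightarrow> 'a::real_normed_vector) \<Rightarrow> real \<Rightarrow> real \<Rightarrow> bool" where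
  "constant_speed \<gamma> a b \<longleftrightarrow>
    (\<exists>\<gamma>' c. continuous_on {a..b} \<gamma>' \<and>
      (\<forall>t\<in>{a..b}. (\<gamma> has_vector_derivative \<gamma>' t) (at t within {a..b}) \<and> norm (\<gamma>' t) = c))"

definition geodesic_segment :: "(real \<Rightarrow> 'a::euclidean_space) \<Rightarrow> real \<Rightarrow> real \<Rightarrow> bool" where
  "geodesic_segment \<gamma> a b \<longleftrightarrow>
    a \<le> b \<and> (\<exists>S. great_circle S \<and> \<gamma> ` {a..b} \<subseteq> S) \<and> constant_speed \<gamma> a b"

definition arc_length :: "(real \<Rightarrow> 'a::real_normed_vector) \<Rightarrow> real \<Rightarrow> real \<Rightarrow> real" where
  "arc_length \<gamma> a b = integral {a..b} (\<lambda>t. norm (vector_derivative \<gamma> (at t within {a..b})))"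

definition minimal_geodesic_segment :: "(real \<Rightarrow> 'a::euclidean_space) \<Rightarrow> real \<Rightarrow> real \<Rightarrow> bool" where
  "minimal_geodesic_segment \<gamma> a b \<longleftrightarrow>
    geodesic_segment \<gamma> a b \<and> arc_length \<gamma> a b = arccos (\<gamma> a \<bullet> \<gamma> b)"

definition spherically_convex :: "'a::euclidean_space set \<Rightarrow> bool" where
  "spherically_convex C \<longleftrightarrow> C \<subseteq> sphere 0 1 \<and>
    (\<forall>x\<in>C. \<forall>y\<in>C. \<forall>\<gamma> a b. minimal_geodesic_segment \<gamma> a b \<and> \<gamma> a = x \<and> \<gamma> b = y
      \<longrightarrow> \<gamma> ` {a..b} \<subseteq> C)"

text \<open>As in \<^const>\<open>convex_on\<close>, convexity of the domain is part of the notion.\<close>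

definition spherically_convex_on :: "'a::euclidean_space set \<Rightarrow> ('a \<Rightarrow> real) \<Rightarrow> bool" where
  "spherically_convex_on C f \<longleftrightarrow> spherically_convex C \<and>
    (\<forall>\<gamma> a b. minimal_geodesic_segment \<gamma> a b \<and> \<gamma> ` {a..b} \<subseteq> C \<longrightarrow> convex_on {a..b} (f \<circ> \<gamma>))"

text \<open>Dimension \<open>2\<close> has to be excluded when quadratic forms \<open>f x = (A *v x) \<bullet> x\<close> on the
  positive part of the sphere are considered: there the positive part is the open quarter circle
  \<open>(cos t, sin t)\<close>, \<open>0 < t < pi / 2\<close>, on which the form \<open>- 2 * x1 * x2 = - sin (2 * t)\<close>
  is spherically convex, although its matrix is not a multiple of the identity.\<close>

end

theory Submission
  imports Defs
begin

text \<open>Take \<open>p\<close> in \<open>C\<close> and a unit vector \<open>v\<close> orthogonal to \<open>p\<close>. A short arc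
  \<open>cos t p + sin t v\<close> around \<open>p\<close> stays in \<open>C\<close>, and in the average of the quadratic form over
  the parameters \<open>t\<close> and \<open>-t\<close> the mixed term cancels. Midpoint convexity at \<open>p\<close> therefore says
  \<open>\<langle>Ap, p\<rangle> \<le> \<langle>Av, v\<rangle>\<close> (lemma \<open>form_le_if_spherically_convex_on\<close>). Here \<open>v\<close> may have any
  signs, and by continuity \<open>p\<close> may lie on the boundary of the orthant
  (lemma \<open>form_le_on_nonneg_orthant\<close>).

  This leaves few matrices. The pairs \<open>(e\<^sub>i, e\<^sub>j)\<close> and \<open>(e\<^sub>j, e\<^sub>i)\<close> make all diagonal entries
  equal; \<open>(e\<^sub>i + e\<^sub>j, e\<^sub>i - e\<^sub>j)\<close> makes the entry at \<open>(i, j)\<close> nonpositive; and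
  \<open>(e\<^sub>k, e\<^sub>i + e\<^sub>j)\<close> with a third index \<open>k\<close> makes it nonnegative. The last pair is where
  dimension 2 drops out. So \<open>A\<close> is a multiple of the identity, and the form is constant on the
  sphere.

  Conversely a constant function is convex along every arc, but spherical convexity of \<open>f\<close>
  includes that of \<open>C\<close>. For this, a curve on the sphere of length \<open>\<ell>\<close> moves through an angle of at
  most \<open>\<ell>\<close> (lemma \<open>angle_le_length\<close>). On a minimal segment the angles from \<open>\<gamma> t\<close> to the two end
  points hence add up to at most the angle between the end points, which forces \<open>\<gamma> t\<close> to be a
  nonnegative combination of them (lemma \<open>unit_vector_between\<close>), hence a positive vector.\<close>

section \<open>Geodesic convexity of the positive part of the sphere\<close>

lemma eq_if_inner_diff_le_0:
  fixes x y :: "'a::real_inner"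
  assumes "(x - y) \<bullet> (x - y) \<le> 0"
  shows "x = y"
proof -
  have "(x - y) \<bullet> (x - y) = 0" using assms inner_ge_zero[of "x - y"] by linarith
  then show ?thesis by simp
qed

lemma inner_derivative_eq_0_if_norm_1:
  fixes \<gamma> :: "real \<Rightarrow> 'a::real_inner"
  assumes "s < t" and r: "r \<in> {s..t}"
    and der: "(\<gamma> has_vector_derivative d) (at r within {s..t})"
    and unit: "\<And>r. r \<in> {s..t} \<Longrightarrow> norm (\<gamma> r) = 1"
  shows "\<gamma> r \<bullet> d = 0"
proof -
  have "((\<lambda>x. \<gamma> x \<bullet> \<gamma> x) has_vector_derivative (\<gamma> r \<bullet> d + d \<bullet> \<gamma> r)) (at r within {s..t})"
    using bounded_bilinear.has_vector_derivative[OF bounded_bilinear_inner der der] .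
  moreover have "((\<lambda>x. \<gamma> x \<bullet> \<gamma> x) has_vector_derivative 0) (at r within {s..t})"
    by (rule has_vector_derivative_transform[OF r _ has_vector_derivative_const[of 1]])
      (use unit in \<open>simp add: norm_eq_1\<close>)
  ultimately have "\<gamma> r \<bullet> d + d \<bullet> \<gamma> r = 0"
    using vector_derivative_unique_within_closed_interval[OF \<open>s < t\<close>] r by (metis cbox_interval)
  then show ?thesis by (simp add: inner_commute)
qed

text \<open>Cauchy-Schwarz after removing from \<open>u\<close> its component along \<open>x\<close>, which \<open>d\<close> does not see.
  For a curve through \<open>x\<close> with velocity \<open>d\<close> it bounds the rate at which the cosine of the angle
  to \<open>u\<close> changes.\<close>

lemma inner_tangent_squared_le:
  fixes u x d :: "'a::real_inner"
  assumes "norm u = 1" "norm x = 1" "x \<bullet> d = 0"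
  shows "(u \<bullet> d)\<^sup>2 \<le> (norm d)\<^sup>2 * (1 - (u \<bullet> x)\<^sup>2)"
proof -
  have "(u - (u \<bullet> x) *\<^sub>R x) \<bullet> d = u \<bullet> d"
    using assms by (simp add: inner_diff_left)
  moreover have "(u - (u \<bullet> x) *\<^sub>R x) \<bullet> (u - (u \<bullet> x) *\<^sub>R x) = 1 - (u \<bullet> x)\<^sup>2"
    using assms by (simp add: norm_eq_1 algebra_simps inner_commute power2_eq_square)
  ultimately show ?thesis
    using Cauchy_Schwarz_ineq[of "u - (u \<bullet> x) *\<^sub>R x" d]
    by (simp add: power2_norm_eq_inner mult.commute)
qed

text \<open>With \<open>\<psi> r = \<gamma> s \<bullet> \<gamma> r\<close>, lemma \<open>inner_tangent_squared_le\<close> gives \<open>\<bar>\<psi>'\<bar> \<le> c sqrt (1 - \<psi>\<^sup>2)\<close>, which is formally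
  the bound \<open>c\<close> on the derivative of \<open>arccos \<circ> \<psi>\<close>. But \<open>arccos\<close> is not differentiable where
  \<open>\<psi> = \<plusminus>1\<close>, in particular at the start of the curve. Replacing \<open>\<psi>\<close> by \<open>m \<psi>\<close> with \<open>0 < m < 1\<close>
  keeps the bound and removes the singularity, so the mean value theorem applies; then \<open>m\<close>
  tends to 1.\<close>

lemma angle_le_length:
  fixes \<gamma> :: "real \<Rightarrow> 'a::real_inner"
  assumes "s \<le> t"
    and der: "\<And>r. r \<in> {s..t} \<Longrightarrow> (\<gamma> has_vector_derivative \<gamma>' r) (at r within {s..t})"
    and speed: "\<And>r. r \<in> {s..t} \<Longrightarrow> norm (\<gamma>' r) \<le> c"
    and unit: "\<And>r. r \<in> {s..t} \<Longrightarrow> norm (\<gamma> r) = 1"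
  shows "arccos (\<gamma> s \<bullet> \<gamma> t) \<le> c * (t - s)"
proof (cases "s = t")
  case True
  then show ?thesis using unit[of s] by (simp add: norm_eq_1)
next
  case False
  with \<open>s \<le> t\<close> have "s < t" by simp
  define \<psi> where "\<psi> r = \<gamma> s \<bullet> \<gamma> r" for r
  have us: "norm (\<gamma> s) = 1" using unit \<open>s < t\<close> by simp
  have c0: "0 \<le> c" using order_trans[OF norm_ge_zero speed[of s]] \<open>s < t\<close> by simp
  have \<psi>1: "\<bar>\<psi> r\<bar> \<le> 1" if "r \<in> {s..t}" for r
    using Cauchy_Schwarz_ineq2[of "\<gamma> s" "\<gamma> r"] unit[OF that] us by (simp add: \<psi>_def)
  have \<psi>s: "\<psi> s = 1" using us by (simp add: \<psi>_def norm_eq_1)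
  have d\<psi>: "(\<psi> has_real_derivative (\<gamma> s \<bullet> \<gamma>' r)) (at r within {s..t})" if "r \<in> {s..t}" for r
    unfolding \<psi>_def has_real_derivative_iff_has_vector_derivative
    using bounded_linear.has_vector_derivative[OF bounded_linear_inner_right der[OF that]] .
  have shrunk: "arccos (m * \<psi> t) - arccos m \<le> c * (t - s)" if m: "m \<in> {0<..<1}" for m
  proof -
    have mlt: "\<bar>m * \<psi> r\<bar> < 1" if "r \<in> {s..t}" for r
    proof -
      have "\<bar>m * \<psi> r\<bar> = m * \<bar>\<psi> r\<bar>" using m by (simp add: abs_mult)
      also have "\<dots> \<le> m * 1" using m \<psi>1[OF that] by (intro mult_left_mono) auto
      finally show ?thesis using m by simp
    qed
    have darc: "((\<lambda>r. arccos (m * \<psi> r)) has_real_derivative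
        inverse (- sqrt (1 - (m * \<psi> r)\<^sup>2)) * (m * (\<gamma> s \<bullet> \<gamma>' r))) (at r within {s..t})"
      if "r \<in> {s..t}" for r
      by (rule DERIV_chain2[OF DERIV_arccos DERIV_cmult[OF d\<psi>[OF that]]])
        (use mlt[OF that] in \<open>auto simp: abs_less_iff\<close>)
    have "\<exists>r\<in>{s<..<t}. arccos (m * \<psi> t) - arccos (m * \<psi> s)
        = inverse (- sqrt (1 - (m * \<psi> r)\<^sup>2)) * (m * (\<gamma> s \<bullet> \<gamma>' r)) * (t - s)"
      by (rule mvt_simple[OF \<open>s < t\<close>], rule darc[unfolded has_field_derivative_def]) simp
    then obtain r where "r \<in> {s<..<t}" and eq: "arccos (m * \<psi> t) - arccos m
        = inverse (- sqrt (1 - (m * \<psi> r)\<^sup>2)) * (m * (\<gamma> s \<bullet> \<gamma>' r)) * (t - s)"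
      unfolding \<psi>s mult_1_right by blast
    then have r: "r \<in> {s..t}" by simp
    let ?R = "1 - (m * \<psi> r)\<^sup>2"
    have R: "0 < ?R" using mlt[OF r] by (simp add: abs_square_less_1)
    have "(\<gamma> s \<bullet> \<gamma>' r)\<^sup>2 \<le> (norm (\<gamma>' r))\<^sup>2 * (1 - (\<psi> r)\<^sup>2)"
      using inner_tangent_squared_le[OF us unit[OF r]
          inner_derivative_eq_0_if_norm_1[OF \<open>s < t\<close> r der[OF r] unit]] by (simp add: \<psi>_def)
    also have "\<dots> \<le> c\<^sup>2 * (1 - (\<psi> r)\<^sup>2)"
      using speed[OF r] \<psi>1[OF r] by (intro mult_right_mono power_mono) (auto simp: abs_square_le_1)
    finally have "m\<^sup>2 * (\<gamma> s \<bullet> \<gamma>' r)\<^sup>2 \<le> m\<^sup>2 * (c\<^sup>2 * (1 - (\<psi> r)\<^sup>2))"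
      by (intro mult_left_mono) auto
    also have "\<dots> = c\<^sup>2 * (m\<^sup>2 - (m * \<psi> r)\<^sup>2)" by (simp add: algebra_simps power2_eq_square)
    also have "\<dots> \<le> c\<^sup>2 * ?R" using m by (intro mult_left_mono) (auto simp: abs_square_le_1)
    finally have "(m * (\<gamma> s \<bullet> \<gamma>' r))\<^sup>2 \<le> (c * sqrt ?R)\<^sup>2"
      using R by (simp add: power_mult_distrib)
    then have "\<bar>m * (\<gamma> s \<bullet> \<gamma>' r)\<bar> \<le> c * sqrt ?R"
      using c0 R by (simp only: abs_le_square_iff[symmetric] abs_mult[of c] abs_of_nonneg real_sqrt_ge_zero less_imp_le)
    then have "inverse (- sqrt ?R) * (m * (\<gamma> s \<bullet> \<gamma>' r)) \<le> c"
      using R by (simp add: field_simps)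
    then show ?thesis unfolding eq using \<open>s < t\<close> by (intro mult_right_mono) auto
  qed
  have "arccos (1 * \<psi> t) - arccos 1 \<le> c * (t - s)"
  proof (rule continuous_le_on_closure[where S = "{0<..<1}" and x = 1])
    have "m * \<bar>\<psi> t\<bar> \<le> 1" if "0 \<le> m" "m \<le> 1" for m
      using that \<psi>1[of t] \<open>s < t\<close> by (intro mult_le_one) auto
    then have "-1 \<le> m * \<psi> t \<and> m * \<psi> t \<le> 1" if "0 \<le> m" "m \<le> 1" for m
      using that by (metis abs_le_iff abs_mult abs_of_nonneg minus_le_iff)
    then show "continuous_on (closure {0<..<1}) (\<lambda>m. arccos (m * \<psi> t) - arccos m)"
      by (auto intro!: continuous_intros)
  qed (use shrunk in auto)
  then show ?thesis by (simp add: \<psi>_def)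
qed

text \<open>Equality in the triangle inequality for angles: if \<open>z\<close> is within \<open>\<tau>\<close> of \<open>x\<close> and within \<open>\<sigma>\<close>
  of \<open>y\<close>, while \<open>x\<close> and \<open>y\<close> are \<open>\<sigma> + \<tau>\<close> apart, then \<open>z\<close> is the point of the arc at these
  distances. The right-hand side \<open>w\<close> has norm \<open>sin (\<sigma> + \<tau>)\<close>, and the addition theorem for \<open>sin\<close>
  bounds \<open>z \<bullet> w\<close> below by the same number: equality in Cauchy-Schwarz.\<close>

lemma unit_vector_between:
  fixes x y z :: "'a::real_inner"
  assumes "norm x = 1" "norm y = 1" "norm z = 1"
    and xy: "x \<bullet> y = cos (\<sigma> + \<tau>)"
    and zx: "cos \<tau> \<le> z \<bullet> x" and zy: "cos \<sigma> \<le> z \<bullet> y"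
    and \<sigma>: "0 \<le> sin \<sigma>" and \<tau>: "0 \<le> sin \<tau>" and \<sigma>\<tau>: "0 \<le> sin (\<sigma> + \<tau>)"
  shows "sin (\<sigma> + \<tau>) *\<^sub>R z = sin \<sigma> *\<^sub>R x + sin \<tau> *\<^sub>R y"
proof -
  define w where "w = sin \<sigma> *\<^sub>R x + sin \<tau> *\<^sub>R y"
  have unit: "x \<bullet> x = 1" "y \<bullet> y = 1" "z \<bullet> z = 1"
    using assms by (auto simp: norm_eq_1)
  have "w \<bullet> w = sin \<sigma> * sin \<sigma> + 2 * sin \<sigma> * sin \<tau> * cos (\<sigma> + \<tau>) + sin \<tau> * sin \<tau>"
    using unit xy inner_commute[of y x]
    by (simp only: w_def inner_add_left inner_add_right inner_scaleR_left inner_scaleR_right) (simp add: distrib_left)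
  also have "\<dots> = (sin \<sigma>)\<^sup>2 * (1 - (sin \<tau>)\<^sup>2)
      + 2 * sin \<sigma> * sin \<tau> * cos \<sigma> * cos \<tau> + (1 - (sin \<sigma>)\<^sup>2) * (sin \<tau>)\<^sup>2"
    unfolding cos_add by (simp add: algebra_simps power2_eq_square)
  also have "\<dots> = (sin (\<sigma> + \<tau>))\<^sup>2"
    unfolding sin_add cos_squared_eq[symmetric] by (simp add: algebra_simps power2_eq_square)
  finally have ww: "w \<bullet> w = (sin (\<sigma> + \<tau>))\<^sup>2" .
  have "sin (\<sigma> + \<tau>) \<le> sin \<sigma> * (z \<bullet> x) + (z \<bullet> y) * sin \<tau>"
    unfolding sin_add using zx zy \<sigma> \<tau> by (intro add_mono mult_left_mono mult_right_mono)
  then have "sin (\<sigma> + \<tau>) \<le> z \<bullet> w" by (simp add: w_def inner_add_right mult.commute)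
  then have "sin (\<sigma> + \<tau>) * sin (\<sigma> + \<tau>) \<le> sin (\<sigma> + \<tau>) * (z \<bullet> w)"
    using \<sigma>\<tau> by (rule mult_left_mono)
  then have "(w - sin (\<sigma> + \<tau>) *\<^sub>R z) \<bullet> (w - sin (\<sigma> + \<tau>) *\<^sub>R z) \<le> 0"
    using ww unit inner_commute[of w z]
    by (simp only: inner_diff_left inner_diff_right inner_scaleR_left inner_scaleR_right power2_eq_square
        right_diff_distrib mult_1_right)
  then have "w = sin (\<sigma> + \<tau>) *\<^sub>R z" by (rule eq_if_inner_diff_le_0)
  then show ?thesis unfolding w_def by (rule sym)
qed

text \<open>Minimality makes \<open>c * (b - a)\<close> the angle \<open>\<theta>\<close> between the end points, so the two pieces into
  which \<open>\<gamma> t\<close> cuts the curve have lengths \<open>\<tau>\<close> and \<open>\<theta> - \<tau>\<close>. Since \<open>\<theta> < pi / 2\<close>, all these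
  angles lie in the range on which \<open>cos\<close> decreases.\<close>

lemma minimal_geodesic_between_end_points:
  fixes \<gamma> :: "real \<Rightarrow> 'a::euclidean_space"
  assumes min: "minimal_geodesic_segment \<gamma> a b" and t: "t \<in> {a..b}"
    and acute: "0 < \<gamma> a \<bullet> \<gamma> b"
  shows "\<exists>\<alpha> \<beta>. 0 \<le> \<alpha> \<and> 0 \<le> \<beta> \<and> 0 < \<alpha> + \<beta> \<and> \<gamma> t = \<alpha> *\<^sub>R \<gamma> a + \<beta> *\<^sub>R \<gamma> b"
proof (cases "a = b")
  case True
  then show ?thesis using t by (intro exI[of _ 1] exI[of _ 0]) auto
next
  case False
  with t have "a < b" by auto
  obtain S where "great_circle S" "\<gamma> ` {a..b} \<subseteq> S"
    using min unfolding minimal_geodesic_segment_def geodesic_segment_def by blast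
  then have unit: "norm (\<gamma> r) = 1" if "r \<in> {a..b}" for r
    using that unfolding great_circle_def by (auto simp: image_subset_iff)
  obtain \<gamma>' c where der: "\<And>r. r \<in> {a..b} \<Longrightarrow> (\<gamma> has_vector_derivative \<gamma>' r) (at r within {a..b})"
    and speed: "\<And>r. r \<in> {a..b} \<Longrightarrow> norm (\<gamma>' r) = c"
    using min unfolding minimal_geodesic_segment_def geodesic_segment_def constant_speed_def by blast
  have c0: "0 \<le> c" using speed[of a] \<open>a < b\<close> by auto
  define \<theta> where "\<theta> = c * (b - a)"
  define \<tau> where "\<tau> = c * (t - a)"
  have \<tau>: "0 \<le> \<tau>" "\<tau> \<le> \<theta>" "\<theta> - \<tau> = c * (b - t)"
    using t c0 unfolding \<tau>_def \<theta>_def by (auto simp: right_diff_distrib intro!: mult_left_mono)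
  have "arc_length \<gamma> a b = integral {a..b} (\<lambda>t. c)"
    unfolding arc_length_def
    by (rule integral_cong)
      (metis \<open>a < b\<close> cbox_interval der speed vector_derivative_within_cbox)
  then have \<theta>: "\<theta> = arccos (\<gamma> a \<bullet> \<gamma> b)"
    using min \<open>a < b\<close> unfolding minimal_geodesic_segment_def \<theta>_def by (simp add: mult.commute)
  have "\<bar>\<gamma> a \<bullet> \<gamma> b\<bar> \<le> 1"
    using Cauchy_Schwarz_ineq2[of "\<gamma> a" "\<gamma> b"] unit \<open>a < b\<close> by simp
  then have cos\<theta>: "\<gamma> a \<bullet> \<gamma> b = cos \<theta>" unfolding \<theta> by (simp add: cos_arccos_abs)
  have \<theta>_lt: "\<theta> < pi / 2"
    unfolding \<theta> using acute \<open>\<bar>\<gamma> a \<bullet> \<gamma> b\<bar> \<le> 1\<close> arccos_less_mono[of "\<gamma> a \<bullet> \<gamma> b" 0] by simp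
  have angle: "cos (c * (r' - r)) \<le> \<gamma> r \<bullet> \<gamma> r'" if "a \<le> r" "r \<le> r'" "r' \<le> b" for r r'
  proof -
    have "arccos (\<gamma> r \<bullet> \<gamma> r') \<le> c * (r' - r)"
    proof (rule angle_le_length[OF \<open>r \<le> r'\<close>])
      fix x assume "x \<in> {r..r'}"
      then have x: "x \<in> {a..b}" using that by auto
      show "(\<gamma> has_vector_derivative \<gamma>' x) (at x within {r..r'})"
        by (rule has_vector_derivative_within_subset[OF der[OF x]]) (use that in auto)
    qed (use speed unit that in auto)
    moreover have "c * (r' - r) \<le> \<theta>"
      unfolding \<theta>_def using that c0 by (intro mult_left_mono) auto
    moreover have le1: "\<bar>\<gamma> r \<bullet> \<gamma> r'\<bar> \<le> 1"
      using Cauchy_Schwarz_ineq2[of "\<gamma> r" "\<gamma> r'"] unit that by simp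
    moreover have "c * (r' - r) \<le> pi" using \<open>c * (r' - r) \<le> \<theta>\<close> \<theta>_lt pi_gt_zero by linarith
    ultimately have "cos (c * (r' - r)) \<le> cos (arccos (\<gamma> r \<bullet> \<gamma> r'))"
      using \<theta>_lt by (intro cos_monotone_0_pi_le arccos_lbound) (auto simp: abs_le_iff)
    then show ?thesis using le1 by (simp add: cos_arccos_abs)
  qed
  have at_a: "cos \<tau> \<le> \<gamma> t \<bullet> \<gamma> a" and at_b: "cos (\<theta> - \<tau>) \<le> \<gamma> t \<bullet> \<gamma> b"
    using angle[of a t] angle[of t b] t \<tau> by (auto simp: \<tau>_def inner_commute)
  have ut: "\<gamma> t \<bullet> \<gamma> t = 1" and ua: "\<gamma> a \<bullet> \<gamma> a = 1" and ub: "\<gamma> b \<bullet> \<gamma> b = 1"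
    using unit t \<open>a < b\<close> by (auto simp: norm_eq_1[symmetric])
  show ?thesis
    \<comment> \<open>\<open>\<theta> = 0\<close> is possible with \<open>a < b\<close>: the curve may be constant.\<close>
  proof (cases "\<theta> = 0")
    case True
    then have "1 \<le> \<gamma> t \<bullet> \<gamma> a" using at_a \<tau> by simp
    then have "(\<gamma> t - \<gamma> a) \<bullet> (\<gamma> t - \<gamma> a) \<le> 0"
      using ut ua by (simp add: inner_diff_left inner_diff_right inner_commute)
    then have "\<gamma> t = \<gamma> a" by (rule eq_if_inner_diff_le_0)
    then show ?thesis by (intro exI[of _ 1] exI[of _ 0]) auto
  next
    case False
    with \<tau> \<theta>_lt have s\<theta>: "0 < sin \<theta>" by (intro sin_gt_zero) auto
    have s1: "0 \<le> sin \<tau>" and s2: "0 \<le> sin (\<theta> - \<tau>)"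
      using \<tau> \<theta>_lt by (auto intro!: sin_ge_zero)
    have "sin (\<theta> - \<tau> + \<tau>) *\<^sub>R \<gamma> t = sin (\<theta> - \<tau>) *\<^sub>R \<gamma> a + sin \<tau> *\<^sub>R \<gamma> b"
      by (rule unit_vector_between[OF _ _ _ _ at_a at_b s2 s1])
        (use unit t \<open>a < b\<close> cos\<theta> s\<theta> in auto)
    then have eq: "sin \<theta> *\<^sub>R \<gamma> t = sin (\<theta> - \<tau>) *\<^sub>R \<gamma> a + sin \<tau> *\<^sub>R \<gamma> b" by simp
    have "(1 / sin \<theta>) *\<^sub>R (sin \<theta> *\<^sub>R \<gamma> t)
        = (sin (\<theta> - \<tau>) / sin \<theta>) *\<^sub>R \<gamma> a + (sin \<tau> / sin \<theta>) *\<^sub>R \<gamma> b"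
      unfolding eq by (simp add: scaleR_add_right)
    then have "\<gamma> t = (sin (\<theta> - \<tau>) / sin \<theta>) *\<^sub>R \<gamma> a + (sin \<tau> / sin \<theta>) *\<^sub>R \<gamma> b"
      using s\<theta> by simp
    moreover have "0 < sin (\<theta> - \<tau>) / sin \<theta> + sin \<tau> / sin \<theta>"
    proof -
      have "sin \<theta> = sin (\<theta> - \<tau>) * cos \<tau> + cos (\<theta> - \<tau>) * sin \<tau>"
        using sin_add[of "\<theta> - \<tau>" \<tau>] by simp
      then have "sin (\<theta> - \<tau>) \<noteq> 0 \<or> sin \<tau> \<noteq> 0"
        using s\<theta> by (metis add_0 less_irrefl mult_zero_left mult_zero_right)
      then have "0 < sin (\<theta> - \<tau>) + sin \<tau>" using s1 s2 by linarith
      then show ?thesis using s\<theta> by (simp add: add_divide_distrib[symmetric])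
    qed
    moreover have "0 \<le> sin (\<theta> - \<tau>) / sin \<theta>" "0 \<le> sin \<tau> / sin \<theta>"
      using s1 s2 s\<theta> by simp_all
    ultimately show ?thesis by blast
  qed
qed

lemma inner_pos_if_positive_orthant:
  fixes x y :: "real ^ 'n"
  assumes "x \<in> positive_orthant" "y \<in> positive_orthant"
  shows "0 < x \<bullet> y"
  unfolding inner_vec_def
  using assms by (intro sum_pos) (auto simp: positive_orthant_def)

lemma spherically_convex_positive_orthant:
  "spherically_convex (sphere 0 1 \<inter> positive_orthant :: (real ^ 'n) set)"
  unfolding spherically_convex_def
proof (intro conjI ballI allI impI subsetI)
  fix x y z :: "real ^ 'n" and \<gamma> :: "real \<Rightarrow> real ^ 'n" and a b
  assume x: "x \<in> sphere 0 1 \<inter> positive_orthant" and y: "y \<in> sphere 0 1 \<inter> positive_orthant"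
    and \<gamma>: "minimal_geodesic_segment \<gamma> a b \<and> \<gamma> a = x \<and> \<gamma> b = y" and "z \<in> \<gamma> ` {a..b}"
  then obtain t where t: "t \<in> {a..b}" "z = \<gamma> t" by auto
  have "z \<in> sphere 0 1"
    using \<gamma> t unfolding minimal_geodesic_segment_def geodesic_segment_def great_circle_def by blast
  moreover obtain \<alpha> \<beta> where ab: "0 \<le> \<alpha>" "0 \<le> \<beta>" "0 < \<alpha> + \<beta>" "z = \<alpha> *\<^sub>R x + \<beta> *\<^sub>R y"
    using minimal_geodesic_between_end_points[of \<gamma> a b t] \<gamma> t x y inner_pos_if_positive_orthant[of x y]
    by auto
  have "0 < z $ i" for i
  proof -
    have "0 < x $ i" "0 < y $ i" using x y by (auto simp: positive_orthant_def)
    moreover have "0 < \<alpha> \<or> 0 < \<beta>" using ab by linarith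
    ultimately show ?thesis using ab by (auto simp: add_pos_nonneg add_nonneg_pos)
  qed
  ultimately show "z \<in> sphere 0 1 \<inter> positive_orthant" by (simp add: positive_orthant_def)
qed auto

section \<open>Convex quadratic forms along short arcs\<close>

text \<open>The bound on \<open>e\<close> keeps the length \<open>2 * e\<close> of the arc within the range \<open>[0, pi]\<close> of \<open>arccos\<close>;
  a longer arc would not be minimal.\<close>

lemma minimal_geodesic_segment_arc:
  fixes p v :: "'a::euclidean_space"
  assumes p: "norm p = 1" and v: "norm v = 1" and orth: "p \<bullet> v = 0"
    and e: "0 < e" "e \<le> pi / 2"
  shows "minimal_geodesic_segment (\<lambda>t. cos t *\<^sub>R p + sin t *\<^sub>R v) (- e) e"
proof -
  let ?\<gamma> = "\<lambda>t. cos t *\<^sub>R p + sin t *\<^sub>R v"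
  let ?\<gamma>' = "\<lambda>t. (- sin t) *\<^sub>R p + cos t *\<^sub>R v"
  have pp: "p \<bullet> p = 1" "v \<bullet> v = 1" "v \<bullet> p = 0"
    using p v orth by (auto simp: norm_eq_1 inner_commute)
  have norm: "norm (x *\<^sub>R p + y *\<^sub>R v) = 1" if "x\<^sup>2 + y\<^sup>2 = 1" for x y
    using that pp orth by (simp add: norm_eq_1 algebra_simps power2_eq_square)
  have der: "(?\<gamma> has_vector_derivative ?\<gamma>' t) (at t within T)" for t T
    by (auto intro!: derivative_eq_intros simp: has_real_derivative_iff_has_vector_derivative[symmetric])
  have speed: "norm (?\<gamma>' t) = 1" for t by (rule norm) simp
  have "great_circle (span {p, v} \<inter> sphere 0 1)"
    unfolding great_circle_def
  proof (intro exI conjI)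
    have "p \<noteq> v" using pp orth by auto
    moreover have "independent {p, v}"
      by (rule pairwise_orthogonal_independent)
        (use pp orth p v in \<open>auto simp: pairwise_def orthogonal_def\<close>)
    ultimately show "dim (span {p, v}) = 2" by (simp add: dim_eq_card_independent)
  qed auto
  moreover have "?\<gamma> ` {-e..e} \<subseteq> span {p, v} \<inter> sphere 0 1"
    using norm by (auto intro!: span_add span_scale intro: span_base)
  moreover have "constant_speed ?\<gamma> (- e) e"
    unfolding constant_speed_def
    by (rule exI[of _ ?\<gamma>'], rule exI[of _ 1]) (use der speed in \<open>auto intro!: continuous_intros\<close>)
  ultimately have "geodesic_segment ?\<gamma> (- e) e"
    unfolding geodesic_segment_def using e by auto
  moreover have "arc_length ?\<gamma> (- e) e = arccos (?\<gamma> (- e) \<bullet> ?\<gamma> e)"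
  proof -
    have "arc_length ?\<gamma> (- e) e = integral {- e..e} (\<lambda>t. 1)"
      unfolding arc_length_def
    proof (rule integral_cong)
      fix t assume "t \<in> {- e..e}"
      then have "vector_derivative ?\<gamma> (at t within {- e..e}) = ?\<gamma>' t"
        using e by (intro vector_derivative_within_cbox[where a = "-e" and b = e, unfolded cbox_interval]) (use der in auto)
      then show "norm (vector_derivative ?\<gamma> (at t within {- e..e})) = 1" using speed by simp
    qed
    also have "\<dots> = 2 * e" using e by simp
    also have "\<dots> = arccos (cos (2 * e))" using e by (simp add: arccos_cos)
    also have "cos (2 * e) = ?\<gamma> (- e) \<bullet> ?\<gamma> e"
      unfolding cos_double cos_minus sin_minus inner_add_left inner_add_right
        inner_scaleR_left inner_scaleR_right pp orth
      by (simp add: power2_eq_square)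
    finally show ?thesis .
  qed
  ultimately show ?thesis unfolding minimal_geodesic_segment_def by blast
qed

lemma open_positive_orthant: "open (positive_orthant :: (real ^ 'n) set)"
proof -
  have "positive_orthant = (\<Inter>i. {x :: real ^ 'n. x $ i > 0})"
    by (auto simp: positive_orthant_def)
  moreover have "open (\<Inter>i. {x :: real ^ 'n. x $ i > 0})"
    by (intro open_INT) (auto simp: open_halfspace_component_gt_cart)
  ultimately show ?thesis by metis
qed

text \<open>Convexity at the midpoint \<open>p\<close> of the arc from \<open>-e\<close> to \<open>e\<close> reads
  \<open>L p \<bullet> p \<le> cos\<^sup>2 e (L p \<bullet> p) + sin\<^sup>2 e (L v \<bullet> v)\<close>, because the mixed terms at the two ends
  have opposite signs. Any \<open>e\<close> with \<open>sin e \<noteq> 0\<close> serves, so \<open>e\<close> can be as small as needed to stay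
  in the open set \<open>U\<close>.\<close>

lemma form_le_if_spherically_convex_on:
  fixes f :: "'a::euclidean_space \<Rightarrow> real" and L :: "'a \<Rightarrow> 'a"
  assumes "linear L" and "open U"
    and conv: "spherically_convex_on (sphere 0 1 \<inter> U) f"
    and f: "\<And>x. x \<in> sphere 0 1 \<inter> U \<Longrightarrow> f x = L x \<bullet> x"
    and pU: "p \<in> U" and p: "norm p = 1" and v: "norm v = 1" and orth: "p \<bullet> v = 0"
  shows "L p \<bullet> p \<le> L v \<bullet> v"
proof -
  let ?\<gamma> = "\<lambda>t. cos t *\<^sub>R p + sin t *\<^sub>R v"
  have "continuous_on UNIV ?\<gamma>" by (intro continuous_intros)
  then have "open (?\<gamma> -` U)" using \<open>open U\<close> by (simp add: open_vimage)
  moreover have "0 \<in> ?\<gamma> -` U" using pU by simp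
  ultimately obtain d where d: "0 < d" "cball 0 d \<subseteq> ?\<gamma> -` U"
    by (meson open_contains_cball)
  define e where "e = min d 1"
  have e: "0 < e" "e \<le> pi / 2" using d pi_ge_two by (auto simp: e_def)
  note arc = minimal_geodesic_segment_arc[OF p v orth e]
  have sub: "?\<gamma> ` {- e..e} \<subseteq> sphere 0 1 \<inter> U"
  proof -
    have "?\<gamma> t \<in> U" if "t \<in> {- e..e}" for t
    proof -
      have "t \<in> cball 0 d" using that by (auto simp: e_def)
      then show ?thesis using d by blast
    qed
    moreover have "?\<gamma> ` {- e..e} \<subseteq> sphere 0 1"
      using arc unfolding minimal_geodesic_segment_def geodesic_segment_def great_circle_def by blast
    ultimately show ?thesis by blast
  qed
  have "convex_on {- e..e} (f \<circ> ?\<gamma>)"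
    using conv arc sub unfolding spherically_convex_on_def by blast
  then have "(f \<circ> ?\<gamma>) ((1 - 1/2) *\<^sub>R (- e) + (1/2) *\<^sub>R e) \<le> (1 - 1/2) * (f \<circ> ?\<gamma>) (- e) + (1/2) * (f \<circ> ?\<gamma>) e"
    by (rule convex_onD) (use e in auto)
  then have "2 * f (?\<gamma> 0) \<le> f (?\<gamma> (- e)) + f (?\<gamma> e)" by simp
  moreover have form: "f (?\<gamma> t) = L (?\<gamma> t) \<bullet> ?\<gamma> t" if "t \<in> {- e..e}" for t
    using f sub that by blast
  ultimately have "2 * (L (?\<gamma> 0) \<bullet> ?\<gamma> 0) \<le> L (?\<gamma> (- e)) \<bullet> ?\<gamma> (- e) + L (?\<gamma> e) \<bullet> ?\<gamma> e"
    using form[of 0] form[of "- e"] form[of e] e by simp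
  also have "\<dots> = 2 * ((cos e)\<^sup>2 * (L p \<bullet> p) + (sin e)\<^sup>2 * (L v \<bullet> v))"
    by (simp add: linear_add[OF \<open>linear L\<close>] linear_scale[OF \<open>linear L\<close>] linear_diff[OF \<open>linear L\<close>]
        inner_add_left inner_add_right inner_diff_left inner_diff_right power2_eq_square algebra_simps)
  also have "(cos e)\<^sup>2 = 1 - (sin e)\<^sup>2" by (simp add: cos_squared_eq)
  finally have "(sin e)\<^sup>2 * (L p \<bullet> p) \<le> (sin e)\<^sup>2 * (L v \<bullet> v)" by (simp add: algebra_simps)
  moreover have "0 < sin e" using e pi_gt_zero by (intro sin_gt_zero) linarith+
  ultimately show ?thesis by simp
qed

section \<open>From the open to the closed orthant\<close>

text \<open>Both sides of the inequality scale in the same way in \<open>p\<close> and in \<open>v\<close>. In this form no unit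
  vectors are needed, and the two sides are continuous in \<open>p\<close> and \<open>v\<close> even at 0.\<close>

lemma form_le_homogeneous:
  fixes L :: "'a::euclidean_space \<Rightarrow> 'a"
  assumes "linear L"
    and cone: "\<And>c x. 0 < c \<Longrightarrow> x \<in> K \<Longrightarrow> c *\<^sub>R x \<in> K"
    and le: "\<And>p v. p \<in> K \<Longrightarrow> norm p = 1 \<Longrightarrow> norm v = 1 \<Longrightarrow> p \<bullet> v = 0 \<Longrightarrow> L p \<bullet> p \<le> L v \<bullet> v"
    and p: "p \<in> K" and orth: "p \<bullet> v = 0"
  shows "(L p \<bullet> p) * (v \<bullet> v) \<le> (L v \<bullet> v) * (p \<bullet> p)"
proof (cases "p = 0 \<or> v = 0")
  case True
  then show ?thesis by (auto simp: linear_0[OF \<open>linear L\<close>])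
next
  case False
  have "L (p /\<^sub>R norm p) \<bullet> (p /\<^sub>R norm p) \<le> L (v /\<^sub>R norm v) \<bullet> (v /\<^sub>R norm v)"
    using False orth by (intro le cone p) auto
  then have "(L p \<bullet> p) / (norm p)\<^sup>2 \<le> (L v \<bullet> v) / (norm v)\<^sup>2"
    by (simp add: linear_scale[OF \<open>linear L\<close>] power2_eq_square divide_inverse mult_ac)
  then show ?thesis using False by (simp add: power2_norm_eq_inner field_simps)
qed

text \<open>The vector \<open>p\<close> is approached by \<open>P e = p + e (1, ..., 1)\<close> with \<open>e > 0\<close>, which is positive.
  Then \<open>v\<close> has to move as well to stay orthogonal; \<open>V e\<close> is its projection to the orthogonal complement of
  \<open>P e\<close>, multiplied by \<open>P e \<bullet> P e\<close> so that it is polynomial in \<open>e\<close>.\<close>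

lemma form_le_on_nonneg_orthant:
  fixes L :: "real ^ 'n \<Rightarrow> real ^ 'n"
  assumes "linear L"
    and le: "\<And>p v. p \<in> positive_orthant \<Longrightarrow> norm p = 1 \<Longrightarrow> norm v = 1 \<Longrightarrow> p \<bullet> v = 0
      \<Longrightarrow> L p \<bullet> p \<le> L v \<bullet> v"
    and nonneg: "\<And>i. 0 \<le> p $ i" and orth: "p \<bullet> v = 0"
  shows "(L p \<bullet> p) * (v \<bullet> v) \<le> (L v \<bullet> v) * (p \<bullet> p)"
proof (cases "p = 0")
  case True
  then show ?thesis by (simp add: linear_0[OF \<open>linear L\<close>])
next
  case False
  define P where "P e = p + e *\<^sub>R 1" for e :: real
  define V where "V e = (P e \<bullet> P e) *\<^sub>R v - (P e \<bullet> v) *\<^sub>R P e" for e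
  let ?h = "\<lambda>e. (L (P e) \<bullet> P e) * (V e \<bullet> V e) - (L (V e) \<bullet> V e) * (P e \<bullet> P e)"
  have cL: "continuous_on S (\<lambda>e. L (g e))" if "continuous_on S g" for S and g :: "real \<Rightarrow> _"
    using that \<open>linear L\<close> by (simp add: linear_continuous_on_compose)
  have "?h 0 \<le> 0"
  proof (rule continuous_le_on_closure[where S = "{0<..<1::real}" and f = ?h and x = 0])
    show "continuous_on (closure {0<..<1}) ?h"
      unfolding P_def V_def by (intro continuous_intros cL)
    fix e :: real assume e: "e \<in> {0<..<1}"
    have "P e \<in> positive_orthant"
      using nonneg e by (simp add: P_def positive_orthant_def add_nonneg_pos)
    moreover have "P e \<bullet> V e = 0" by (simp add: V_def inner_diff_right)
    moreover have "c *\<^sub>R x \<in> positive_orthant" if "0 < c" "x \<in> positive_orthant" for c and x :: "real ^ 'n"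
      using that by (simp add: positive_orthant_def)
    ultimately show "?h e \<le> 0"
      using form_le_homogeneous[of L positive_orthant "P e" "V e"] \<open>linear L\<close> le by simp
  qed auto
  moreover have "P 0 = p" "V 0 = (p \<bullet> p) *\<^sub>R v" using orth by (auto simp: P_def V_def)
  ultimately have "(p \<bullet> p)\<^sup>2 * ((L p \<bullet> p) * (v \<bullet> v)) \<le> (p \<bullet> p)\<^sup>2 * ((L v \<bullet> v) * (p \<bullet> p))"
    by (simp add: linear_scale[OF \<open>linear L\<close>] power2_eq_square mult_ac)
  then show ?thesis using False by simp
qed

section \<open>Test vectors that determine the matrix\<close>

lemma inner_axis_matrix_vector: "(A *v axis j 1) \<bullet> axis i 1 = (A $ i $ j :: real)"
  by (simp add: inner_axis matrix_vector_mult_basis column_def)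

lemma obtain_third_index:
  assumes "CARD('n::finite) \<noteq> 2" and "i \<noteq> (j :: 'n)"
  obtains k where "k \<noteq> i" "k \<noteq> j"
proof -
  have "card {i, j} = 2" using assms by simp
  then have "{i, j} \<noteq> UNIV" using assms by metis
  then show ?thesis using that by blast
qed

text \<open>Each relation comes from one test pair \<open>(p, v)\<close> of orthogonal vectors, \<open>p\<close> nonnegative, with
  entries 0 and \<open>\<plusminus>1\<close>.\<close>

lemma scalar_matrix_if_form_le:
  fixes A :: "real ^ 'n ^ 'n"
  assumes dim: "CARD('n) \<noteq> 2" and sym: "A = transpose A"
    and le: "\<And>p v. (\<And>i. 0 \<le> p $ i) \<Longrightarrow> p \<bullet> v = 0
      \<Longrightarrow> ((A *v p) \<bullet> p) * (v \<bullet> v) \<le> ((A *v v) \<bullet> v) * (p \<bullet> p)"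
  shows "\<exists>l::real. A = l *\<^sub>R mat 1"
proof -
  let ?e = "\<lambda>i::'n. axis i 1 :: real ^ 'n"
  have sym': "A $ i $ j = A $ j $ i" for i j
    using arg_cong[OF sym, of "\<lambda>M. M $ i $ j"] by (simp add: transpose_def)
  have ee: "?e i \<bullet> ?e j = (if i = j then 1 else 0)" for i j by (simp add: inner_axis_axis)
  have nonneg: "0 \<le> ?e i $ k" for i k by (simp add: axis_def)
  note expand = matrix_vector_right_distrib matrix_vector_mult_diff_distrib inner_add_left
    inner_add_right inner_diff_left inner_diff_right inner_axis_matrix_vector ee
  have diag_le: "A $ i $ i \<le> A $ j $ j" if "i \<noteq> j" for i j
  proof -
    have "((A *v ?e i) \<bullet> ?e i) * (?e j \<bullet> ?e j) \<le> ((A *v ?e j) \<bullet> ?e j) * (?e i \<bullet> ?e i)"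
      by (rule le) (use that in \<open>auto simp: ee nonneg\<close>)
    then show ?thesis by (simp add: expand)
  qed
  then have diag: "A $ i $ i = A $ j $ j" for i j by (cases "i = j") (auto intro: antisym)
  have off: "A $ i $ j = 0" if ij: "i \<noteq> j" for i j
  proof (rule antisym)
    \<comment> \<open>The diagonal parts of the two values agree, so only the off-diagonal parts
      \<open>2 * A $ i $ j\<close> and \<open>- 2 * A $ i $ j\<close> are compared.\<close>
    have "((A *v (?e i + ?e j)) \<bullet> (?e i + ?e j)) * ((?e i - ?e j) \<bullet> (?e i - ?e j))
        \<le> ((A *v (?e i - ?e j)) \<bullet> (?e i - ?e j)) * ((?e i + ?e j) \<bullet> (?e i + ?e j))"
      by (rule le) (use ij in \<open>auto simp: expand nonneg\<close>)
    then show "A $ i $ j \<le> 0" using ij sym'[of i j] by (simp add: expand)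
    obtain k where k: "k \<noteq> i" "k \<noteq> j" using obtain_third_index[OF dim ij] .
    \<comment> \<open>With \<open>\<lambda>\<close> the common diagonal entry, this is \<open>2 * \<lambda> \<le> 2 * \<lambda> + 2 * A $ i $ j\<close>.\<close>
    have "((A *v ?e k) \<bullet> ?e k) * ((?e i + ?e j) \<bullet> (?e i + ?e j))
        \<le> ((A *v (?e i + ?e j)) \<bullet> (?e i + ?e j)) * (?e k \<bullet> ?e k)"
      by (rule le) (use ij k in \<open>auto simp: expand nonneg\<close>)
    then show "0 \<le> A $ i $ j" using ij k sym'[of i j] diag[of i k] diag[of j k] by (simp add: expand)
  qed
  obtain i0 :: 'n where True by blast
  have "A = (A $ i0 $ i0) *\<^sub>R mat 1"
    using diag off by (auto simp: vec_eq_iff mat_def)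
  then show ?thesis by blast
qed

theorem theorem1:
  fixes A :: "real ^ 'n ^ 'n"
    and C :: "(real ^ 'n) set"
    and f :: "real ^ 'n \<Rightarrow> real"
  assumes dim_ne_2: "CARD('n) \<noteq> 2"
    and symmetric: "A = transpose A"
    and C_eq: "C = sphere 0 1 \<inter> positive_orthant"
    and f_eq: "\<And>x. x \<in> C \<Longrightarrow> f x = (A *v x) \<bullet> x"
  shows "(spherically_convex_on C f \<longleftrightarrow> (\<exists>l::real. A = l *\<^sub>R mat 1)) \<and>
    (spherically_convex_on C f \<longrightarrow> f constant_on C)"
proof -
  have scalar: "\<exists>l::real. A = l *\<^sub>R mat 1" if conv: "spherically_convex_on C f"
  proof (rule scalar_matrix_if_form_le[OF dim_ne_2 symmetric])
    have "(A *v p) \<bullet> p \<le> (A *v v) \<bullet> v"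
      if "p \<in> positive_orthant" "norm p = 1" "norm v = 1" "p \<bullet> v = 0" for p v
      by (rule form_le_if_spherically_convex_on[OF matrix_vector_mul_linear open_positive_orthant
            conv[unfolded C_eq] f_eq[unfolded C_eq]])
        (use that in auto)
    then show "((A *v p) \<bullet> p) * (v \<bullet> v) \<le> ((A *v v) \<bullet> v) * (p \<bullet> p)"
      if "\<And>i. 0 \<le> p $ i" "p \<bullet> v = 0" for p v
      using form_le_on_nonneg_orthant[OF matrix_vector_mul_linear] that by blast
  qed
  have const: "f x = l" if "A = l *\<^sub>R mat 1" "x \<in> C" for l x
    using f_eq[OF that(2)] that
    by (simp add: C_eq scaleR_matrix_vector_assoc[symmetric] norm_eq_1)
  have "spherically_convex_on C f" if A: "A = l *\<^sub>R mat 1" for l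
    unfolding spherically_convex_on_def
  proof (intro conjI allI impI)
    show "spherically_convex C" unfolding C_eq by (rule spherically_convex_positive_orthant)
    fix \<gamma> and a b :: real
    assume "minimal_geodesic_segment \<gamma> a b \<and> \<gamma> ` {a..b} \<subseteq> C"
    then have "f (\<gamma> t) = l" if "t \<in> {a..b}" for t using const[OF A] that by blast
    moreover have "(1 - u) *\<^sub>R x + u *\<^sub>R y \<in> {a..b}" if "0 < u" "u < 1" "x \<in> {a..b}" "y \<in> {a..b}" for u x y
      using that by (intro convexD_alt) auto
    ultimately show "convex_on {a..b} (f \<circ> \<gamma>)"
      by (intro convex_onI) (simp_all add: algebra_simps)
  qed
  then show ?thesis using scalar const unfolding constant_on_def by blast
qed

end
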